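(* Let $q$ be a prime power, let $k\ge 2$ and $n\ge 2k+1$ be integers, and let $V$ be an $n$-dimensional vector space over $\mathbb{F}_q$. If $\mathcal{F}\subseteq \mathrm{Gr}_k(V)$ is intersecting, then $$\sigma_{k,q}(\mathcal{F})\le \binom{k}{1}_q\binom{n-2}{k-2}_q .$$ Equality holds if and only if $\mathcal{F}$ is a full point-star, i.e. $\mathcal{F}=\{F\in\mathrm{Gr}_k(V): X\le F\}$ for some $1$-dimensional subspace $X$ of $V$.
   Context: $\binom{a}{b}_q=\prod_{i=0}^{b-1}\frac{q^{a-i}-1}{q^{b-i}-1}$ is the Gaussian coefficient, with $\binom{a}{b}_q=0$ if $b<0$ or $b>a$. $\mathrm{Gr}_k(V)$ is the set of all $k$-dimensional subspaces of $V$; the elements of $\mathrm{Gr}_1(V)$ are called (projective) points. A family $\mathcal{F}\subseteq\mathrm{Gr}_k(V)$ is intersecting if $\dim(F\cap F')\ge1$ for all $F,F'\in\mathcal{F}$. For a point $x$, $d_{\mathcal{F}}(x)=|\{F\in\mathcal{F}:x\le F\}|$; for $S\in\mathrm{Gr}_k(V)$, $d_{\mathcal{F}}(S)=\sum_{x\in\mathrm{Gr}_1(S)}d_{\mathcal{F}}(x)$. For $\mathcal{F}\ne\mathrm{Gr}_k(V)$ the projective Ore-degree is $\sigma_{k,q}(\mathcal{F})=\min\{d_{\mathcal{F}}(S):S\in\mathrm{Gr}_k(V)\setminus\mathcal{F}\}$. *)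

theory Defs
  imports Complex_Main "HOL-Library.Cardinality"
begin

text \<open>For \<open>b \<le> a\<close> the exponents below are genuine differences, since \<open>i < b \<le> a\<close>.
  The convention for negative \<open>b\<close> is void because the arguments are natural numbers.\<close>

definition gaussian :: "nat \<Rightarrow> nat \<Rightarrow> nat \<Rightarrow> real" where
  "gaussian q a b =
    (if b > a then 0
     else (\<Prod>i<b. (real q ^ (a - i) - 1) / (real q ^ (b - i) - 1)))"

text \<open>The parameter \<open>scale\<close> is the scalar multiplication of the ambient vector space, as in
  the locale \<open>vector_space\<close>; subspaces are sets of vectors. The library's \<open>dim\<close> is \<open>0\<close> for
  spaces without a finite basis, so a positive \<open>dim\<close> entails finite dimension.\<close>

definition Gr :: "('a::field \<Rightarrow> 'v::ab_group_add \<Rightarrow> 'v) \<Rightarrow> nat \<Rightarrow> 'v set \<Rightarrow> 'v set set" where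
  "Gr scale k V =
    {W. module.subspace scale W \<and> W \<subseteq> V \<and> vector_space.dim scale W = k}"

definition intersecting :: "('a::field \<Rightarrow> 'v::ab_group_add \<Rightarrow> 'v) \<Rightarrow> 'v set set \<Rightarrow> bool" where
  "intersecting scale \<F> \<longleftrightarrow>
    (\<forall>F\<in>\<F>. \<forall>F'\<in>\<F>. vector_space.dim scale (F \<inter> F') \<ge> 1)"

definition point_degree :: "'v set set \<Rightarrow> 'v set \<Rightarrow> nat" where
  "point_degree \<F> x = card {F \<in> \<F>. x \<subseteq> F}"

definition subspace_degree ::
    "('a::field \<Rightarrow> 'v::ab_group_add \<Rightarrow> 'v) \<Rightarrow> 'v set set \<Rightarrow> 'v set \<Rightarrow> nat" where
  "subspace_degree scale \<F> S = (\<Sum>x\<in>Gr scale 1 S. point_degree \<F> x)"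

text \<open>Only meaningful for \<open>\<F> \<noteq> Gr scale k V\<close>: otherwise this is the unspecified minimum
  of the empty set.\<close>

definition ore_degree ::
    "('a::field \<Rightarrow> 'v::ab_group_add \<Rightarrow> 'v) \<Rightarrow> nat \<Rightarrow> 'v set \<Rightarrow> 'v set set \<Rightarrow> nat" where
  "ore_degree scale k V \<F> = Min (subspace_degree scale \<F> ` (Gr scale k V - \<F>))"

definition full_point_star ::
    "('a::field \<Rightarrow> 'v::ab_group_add \<Rightarrow> 'v) \<Rightarrow> nat \<Rightarrow> 'v set \<Rightarrow> 'v set set \<Rightarrow> bool" where
  "full_point_star scale k V \<F> \<longleftrightarrow>
    (\<exists>X\<in>Gr scale 1 V. \<F> = {F \<in> Gr scale k V. X \<subseteq> F})"

end

theory Submission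
  imports Defs
begin

text \<open>Write \<open>[d] = (q^d - 1) / (q - 1)\<close> for the number of points of a \<open>d\<close>-dimensional space and
  \<open>N_j\<close> for the number of \<open>k\<close>-spaces that contain a fixed \<open>j\<close>-space, so that the bound of the
  theorem is \<open>[k] N_2\<close>. Sums over points are computed as sums over nonzero vectors, each point
  being counted \<open>q - 1\<close> times.

  For the full star of a point \<open>X\<close>, every \<open>k\<close>-space \<open>S\<close> off \<open>X\<close> has \<open>[k]\<close> points, each spanning
  with \<open>X\<close> a line that lies in \<open>N_2\<close> members; so every nonmember has degree exactly \<open>[k] N_2\<close>
  (\<open>subspace_degree_star\<close>). If \<open>\<F>\<close> is a proper part of that star, an \<open>S\<close> off \<open>X\<close> through a
  vector of a missing member has smaller degree (\<open>exists_below_star\<close>).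

  There remain the families whose members have no common nonzero vector. Fix a member \<open>Y\<close>
  and average the degree over the \<open>k\<close>-spaces \<open>S\<close> with \<open>S \<inter> Y = 0\<close>, none of which belongs to
  \<open>\<F>\<close>. Such an \<open>S\<close> is equally likely to contain each vector outside \<open>Y\<close>, and each member has at
  most \<open>q^k - q\<close> vectors outside \<open>Y\<close>. Hence some \<open>S\<close> has degree below \<open>[k] N_2\<close> provided that
  \<open>|\<F>| (q^k - q) < (q^n - q^k) N_2\<close>. This asks for slightly less than the size of a full
  star. For \<open>k \<ge> 3\<close> it follows from \<open>|\<F>| \<le> 2 [k] N_2\<close>, and this estimate is the core of the
  proof: for \<open>q = 2\<close> and \<open>n = 2k + 1\<close> a full star has only slightly more than
  \<open>2 [k] N_2\<close> members, so there is no constant factor to waste.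

  Call a subspace a cover if it meets every member; the smallest covers have some dimension
  \<open>l \<ge> 2\<close>. A subspace \<open>M\<close> that is not a cover misses some member \<open>A\<close>, and every member
  containing \<open>M\<close> contains one of the \<open>[k]\<close> subspaces \<open>M + x\<close>, where \<open>x\<close> is a point of \<open>A\<close>.
  Iterating this up to dimension \<open>t\<close> bounds the number of members above \<open>M\<close> by
  \<open>[k]^(t - dim M) N_t\<close>, as long as no cover is met on the way (\<open>degree_le_chain\<close>). Every such
  step taken beyond dimension \<open>2\<close> gains a factor of at least \<open>q\<close>, because \<open>[k] N_(j+1) \<le> N_j / q\<close>
  when \<open>n \<ge> 2k + 1\<close>. If \<open>l = k\<close>, the bound \<open>[k]^k\<close> is enough. If \<open>l < k\<close>, branching over the
  \<open>[l]\<close> points of a smallest cover \<open>L\<close> yields \<open>[l] [k]^(l-1) N_l\<close>, which is too large by a factor of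
  almost \<open>2\<close> in the extreme case. The missing factor comes from the intersection \<open>X\<close> of all covers
  of dimension less than \<open>k\<close>. A point outside \<open>X\<close> is avoided by a cover of dimension at most
  \<open>k - 1\<close>, which gives \<open>[k-1]\<close> branches instead of \<open>[k]\<close>. A member that does not contain \<open>X\<close>
  has no cover of dimension less than \<open>k\<close> inside it, so there the chain can be continued to
  dimension \<open>l + 1\<close>. If \<open>X \<noteq> 0\<close>, the members containing \<open>X\<close> are few unless \<open>X\<close> is a single
  point, and in that case they are exactly the members meeting \<open>X\<close>
  (\<open>card_family_le_small_cover\<close>).\<close>

section \<open>Counting in vector spaces over finite fields\<close>

locale finite_field_space =
  finite_dimensional_vector_space scale Basis
  for scale :: "'a::{field,finite} \<Rightarrow> 'v::ab_group_add \<Rightarrow> 'v" and Basis :: "'v set" +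
  fixes q :: real and n :: nat
  assumes q_eq: "q = real CARD('a)"
    and card_Basis [simp]: "card Basis = n"
begin

lemma q_ge_2: "q \<ge> 2"
proof -
  have "card {0, 1 :: 'a} \<le> CARD('a)" by (rule card_mono) auto
  then show ?thesis by (simp add: q_eq)
qed

lemma finite_card_span:
  assumes "finite B" "independent B"
  shows "finite (span B) \<and> card (span B) = CARD('a) ^ card B"
  using assms
proof (induction B rule: finite_induct)
  case empty
  then show ?case by simp
next
  case (insert b B)
  have ind: "independent B" and b: "b \<notin> span B"
    using insert.prems insert.hyps by (auto simp: independent_insert)
  let ?f = "\<lambda>(c, x). scale c b + x"
  have img: "span (insert b B) = ?f ` (UNIV \<times> span B)"
  proof (rule set_eqI)
    fix x
    have "x \<in> span (insert b B) \<longleftrightarrow> (\<exists>c. x - scale c b \<in> span B)"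
      by (rule span_breakdown_eq)
    also have "\<dots> \<longleftrightarrow> x \<in> ?f ` (UNIV \<times> span B)"
      by (simp add: image_iff split_beta) (metis add_diff_cancel_left' add.commute diff_add_cancel)
    finally show "x \<in> span (insert b B) \<longleftrightarrow> x \<in> ?f ` (UNIV \<times> span B)" .
  qed
  have "inj_on ?f (UNIV \<times> span B)"
  proof (rule inj_onI, clarify)
    fix c d x y
    assume x: "x \<in> span B" and y: "y \<in> span B" and eq: "scale c b + x = scale d b + y"
    have "scale (c - d) b = y - x" using eq by (simp add: scale_left_diff_distrib algebra_simps)
    then have "scale (c - d) b \<in> span B" using x y by (simp add: span_diff)
    then have "c = d" using b
      by (metis eq_iff_diff_eq_0 span_scale scale_scale left_inverse scale_one)
    then show "c = d \<and> x = y" using eq by simp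
  qed
  then show ?case
    using insert ind by (simp add: img card_image card_cartesian_product)
qed

lemma finite_vectors [simp]: "finite (A :: 'v set)"
  using finite_card_span[OF finite_Basis independent_Basis] span_Basis
  by (metis finite_subset subset_UNIV)

lemma card_subspace: "subspace W \<Longrightarrow> real (card W) = q ^ dim W"
proof -
  assume W: "subspace W"
  obtain B where B: "B \<subseteq> W" "independent B" "W \<subseteq> span B" "card B = dim W"
    using basis_exists by blast
  then have "span B = W" using W by (simp add: span_subspace)
  then show ?thesis using finite_card_span[of B] B by (simp add: q_eq finiteI_independent)
qed

lemma card_subspace_diff:
  assumes "subspace U" "subspace W" "U \<subseteq> W"
  shows "real (card (W - U)) = q ^ dim W - q ^ dim U"
  using assms by (simp add: card_Diff_subset card_mono of_nat_diff card_subspace)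

lemma Gr_iff: "W \<in> Gr scale d V \<longleftrightarrow> subspace W \<and> W \<subseteq> V \<and> dim W = d"
  by (simp add: Gr_def)

lemma finite_Gr [simp]: "finite (Gr scale d V)"
  by (rule finite_subset[of _ "UNIV"]) (auto simp: Finite_Set.finite_set)

lemma dim_pos_iff: "subspace W \<Longrightarrow> dim W \<ge> 1 \<longleftrightarrow> \<not> W \<subseteq> {0}"
  by (simp add: Suc_le_eq neq0_conv[symmetric] del: neq0_conv)

lemma dim_span_insert: "subspace M \<Longrightarrow> v \<notin> M \<Longrightarrow> dim (span (insert v M)) = dim M + 1"
  by (simp add: dim_insert span_eq_iff[THEN iffD2])

lemma span_insert_subset_iff:
  "subspace M \<Longrightarrow> subspace S \<Longrightarrow> span (insert v M) \<subseteq> S \<longleftrightarrow> M \<subseteq> S \<and> v \<in> S"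
  by (metis insert_subset span_minimal span_superset subset_trans)

definition avoiding :: "nat \<Rightarrow> 'v set \<Rightarrow> 'v set \<Rightarrow> 'v set set" where
  "avoiding k L M = {S \<in> Gr scale k UNIV. M \<subseteq> S \<and> S \<inter> L \<subseteq> {0}}"

text \<open>Double counting of the pairs \<open>(v, S)\<close> with \<open>v \<in> S - M\<close>, by downward induction on the dimension
  of \<open>M\<close>: a vector outside \<open>M + L\<close> extends \<open>M\<close> to a subspace of the same kind, whereas no
  admissible \<open>S\<close> contains a vector of \<open>M + L\<close> outside \<open>M\<close>. The identity is kept free of
  quotients, so that it holds also when \<open>dim L + k > n\<close> and both sides vanish.\<close>

lemma card_avoiding:
  assumes L: "subspace L" and M: "subspace M" and MpL: "M \<inter> L \<subseteq> {0}" and le: "dim M \<le> k"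
  shows "real (card (avoiding k L M)) * (\<Prod>t\<in>{dim M..<k}. q ^ k - q ^ t)
       = (\<Prod>t\<in>{dim M..<k}. q ^ n - q ^ (dim L + t))"
  using M MpL le
proof (induction "k - dim M" arbitrary: M)
  case 0
  then have "dim M = k" by simp
  have "avoiding k L M = {M}"
    using 0 \<open>dim M = k\<close> subspace_dim_equal by (fastforce simp: avoiding_def Gr_iff)
  then show ?case using \<open>dim M = k\<close> by simp
next
  case (Suc d)
  define i where "i = dim M"
  have ik: "i < k" using Suc.hyps i_def by simp
  let ?P = "\<lambda>j. \<Prod>t\<in>{j..<k}. q ^ k - q ^ t"
  let ?R = "\<lambda>j. \<Prod>t\<in>{j..<k}. q ^ n - q ^ (dim L + t)"
  define MpL where "MpL = {x + y |x y. x \<in> M \<and> y \<in> L}"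
  have subMpL: "subspace MpL" unfolding MpL_def using subspace_sums[OF Suc.prems(1) L] .
  have "M \<inter> L = {0}" using Suc.prems L by (auto simp: subspace_0)
  then have dimMpL: "dim MpL = dim L + i"
    unfolding MpL_def i_def using dim_sums_Int[OF Suc.prems(1) L] by simp
  have M_MpL: "M \<subseteq> MpL"
  proof
    fix x assume "x \<in> M"
    then show "x \<in> MpL" unfolding MpL_def using subspace_0[OF L] by (metis (mono_tags, lifting) add.right_neutral mem_Collect_eq)
  qed
  have L_MpL: "L \<subseteq> MpL"
  proof
    fix x assume "x \<in> L"
    then show "x \<in> MpL" unfolding MpL_def using subspace_0[OF Suc.prems(1)]
      by (metis (mono_tags, lifting) add.left_neutral mem_Collect_eq)
  qed
  have fin: "finite (avoiding k L M)" by (simp add: avoiding_def)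
  have stay: "{S \<in> avoiding k L M. v \<in> S} = avoiding k L (span (insert v M))" for v
    unfolding avoiding_def Gr_iff using span_insert_subset_iff[OF Suc.prems(1)] by blast
  have in_sum: "card {S \<in> avoiding k L M. v \<in> S} = 0" if v: "v \<in> MpL - M" for v
  proof -
    have "False" if S: "S \<in> avoiding k L M" "v \<in> S" for S
    proof -
      obtain x y where xy: "v = x + y" "x \<in> M" "y \<in> L" using v MpL_def by blast
      have "y = v - x" using xy by simp
      moreover have "v - x \<in> S" using S xy by (intro subspace_diff) (auto simp: avoiding_def Gr_iff)
      ultimately have "y = 0" using S xy by (auto simp: avoiding_def)
      then show False using xy v by simp
    qed
    then have "{S \<in> avoiding k L M. v \<in> S} = {}" by blast
    then show ?thesis by (simp only: card.empty)
  qed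
  have out_sum: "real (card {S \<in> avoiding k L M. v \<in> S}) * ?P (Suc i) = ?R (Suc i)"
    if v: "v \<notin> MpL" for v
  proof -
    have vM: "v \<notin> M" using v M_MpL by blast
    then have d: "dim (span (insert v M)) = Suc i"
      using dim_span_insert[OF Suc.prems(1) vM] by (simp add: i_def)
    have "span (insert v M) \<inter> L \<subseteq> {0}"
    proof
      fix x assume x: "x \<in> span (insert v M) \<inter> L"
      then obtain c where c: "x - scale c v \<in> M"
        using span_breakdown_eq[of x v M] Suc.prems(1) by (auto simp: span_eq_iff[THEN iffD2])
      have "c = 0"
      proof (rule ccontr)
        assume "c \<noteq> 0"
        have "x - (x - scale c v) \<in> MpL"
          using subspace_diff[OF subMpL, of x "x - scale c v"] c x M_MpL L_MpL by blast
        then have "scale (inverse c) (scale c v) \<in> MpL"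
          using subspace_scale[OF subMpL, of "scale c v"] by simp
        then show False using v \<open>c \<noteq> 0\<close> by simp
      qed
      then show "x \<in> {0}" using c x Suc.prems by auto
    qed
    then show ?thesis
      using Suc.hyps(1)[of "span (insert v M)"] Suc.hyps(2) d ik
      by (simp add: stay i_def)
  qed
  have "real (card (avoiding k L M)) * (q ^ k - q ^ i)
      = (\<Sum>S\<in>avoiding k L M. real (card (S - M)))"
    using Suc.prems by (simp add: card_subspace_diff avoiding_def Gr_iff i_def)
  also have "\<dots> = real (\<Sum>S\<in>avoiding k L M. card {v \<in> UNIV - M. v \<in> S})"
    by (auto intro!: sum.cong arg_cong[of _ _ card])
  also have "\<dots> = real (\<Sum>v\<in>UNIV - M. card {S \<in> avoiding k L M. v \<in> S})"
    using sum_multicount_gen[OF fin, of "UNIV - M" "\<lambda>S v. v \<in> S"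
        "\<lambda>v. card {S \<in> avoiding k L M. v \<in> S}"] by simp
  also have "\<dots> = (\<Sum>v\<in>UNIV - MpL. real (card {S \<in> avoiding k L M. v \<in> S}))"
    unfolding of_nat_sum
    by (rule sum.mono_neutral_right) (use M_MpL in_sum in auto)
  finally have "real (card (avoiding k L M)) * (q ^ k - q ^ i) * ?P (Suc i)
      = (\<Sum>v\<in>UNIV - MpL. real (card {S \<in> avoiding k L M. v \<in> S}) * ?P (Suc i))"
    by (simp add: sum_distrib_right)
  also have "\<dots> = (\<Sum>v\<in>UNIV - MpL. ?R (Suc i))"
    by (rule sum.cong) (use out_sum in auto)
  also have "\<dots> = (q ^ n - q ^ (dim L + i)) * ?R (Suc i)"
    using card_subspace_diff[OF subMpL, of UNIV] by (simp add: dimMpL)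
  finally show ?case
    using ik unfolding i_def[symmetric] by (simp add: prod.atLeast_Suc_lessThan mult.assoc)
qed

lemma q_power_less: "i < j \<Longrightarrow> q ^ i < q ^ j"
  using q_ge_2 by (intro power_strict_increasing) auto

lemma q_power_le: "i \<le> j \<Longrightarrow> q ^ i \<le> q ^ j"
  using q_ge_2 by (intro power_increasing) auto

lemma card_nonzero_vectors:
  assumes "subspace S"
  shows "real (card (S - {0})) = q ^ dim S - 1"
proof -
  have "real (card (S - {0})) = q ^ dim S - q ^ dim {0 :: 'v}"
    by (rule card_subspace_diff) (use assms subspace_0 in auto)
  also have "dim {0 :: 'v} = 0" by simp
  finally show ?thesis by simp
qed

lemma avoiding_nonempty:
  assumes "subspace L" "subspace M" "M \<inter> L \<subseteq> {0}" "dim M \<le> k" "dim L + k \<le> n"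
  shows "avoiding k L M \<noteq> {}"
proof -
  have "(\<Prod>t\<in>{dim M..<k}. q ^ n - q ^ (dim L + t)) > 0"
    using assms(5) by (intro prod_pos) (auto intro!: q_power_less)
  then have "real (card (avoiding k L M)) \<noteq> 0"
    using card_avoiding[OF assms(1-4)] by (metis less_irrefl mult_zero_left)
  then show ?thesis by (metis card.empty of_nat_0)
qed

text \<open>The \<open>q\<close>-analogue of \<open>d\<close>, which is the number of points of a \<open>d\<close>-dimensional space.\<close>

definition bracket :: "nat \<Rightarrow> real" where
  "bracket d = (q ^ d - 1) / (q - 1)"

text \<open>The number of \<open>k\<close>-spaces above a fixed \<open>j\<close>-space, as \<open>card_above\<close> shows. The index \<open>t\<close> is
  the dimension reached before a further vector is chosen; in this form the recursion in \<open>j\<close> is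
  immediate.\<close>

definition num_above :: "nat \<Rightarrow> nat \<Rightarrow> real" where
  "num_above k j = (\<Prod>t\<in>{j..<k}. (q ^ n - q ^ t) / (q ^ k - q ^ t))"

lemma bracket_mult: "(q - 1) * bracket d = q ^ d - 1"
  using q_ge_2 by (simp add: bracket_def)

lemma bracket_0 [simp]: "bracket 0 = 0" and bracket_1 [simp]: "bracket (Suc 0) = 1"
  using q_ge_2 by (auto simp: bracket_def)

lemma bracket_Suc: "bracket (Suc d) = q * bracket d + 1"
  using q_ge_2 by (simp add: bracket_def field_simps)

lemma bracket_nonneg [simp]: "bracket d \<ge> 0"
  using q_ge_2 by (induction d) (auto simp: bracket_Suc)

lemma num_above_self [simp]: "num_above k k = 1"
  by (simp add: num_above_def)

lemma num_above_pos: "k \<le> n \<Longrightarrow> num_above k j > 0"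
  unfolding num_above_def by (intro prod_pos) (auto intro!: divide_pos_pos q_power_less)

lemma num_above_Suc:
  assumes "j < k"
  shows "(q ^ k - q ^ j) * num_above k j = (q ^ n - q ^ j) * num_above k (Suc j)"
  using q_power_less[OF assms] assms by (simp add: num_above_def prod.atLeast_Suc_lessThan)

lemma card_above:
  assumes "subspace M" "dim M \<le> k"
  shows "real (card {S \<in> Gr scale k UNIV. M \<subseteq> S}) = num_above k (dim M)"
proof -
  have P: "(\<Prod>t\<in>{dim M..<k}. q ^ k - q ^ t) > 0"
    by (intro prod_pos) (auto intro!: q_power_less)
  have "avoiding k {0} M = {S \<in> Gr scale k UNIV. M \<subseteq> S}"
    by (auto simp: avoiding_def)
  then have "real (card {S \<in> Gr scale k UNIV. M \<subseteq> S}) * (\<Prod>t\<in>{dim M..<k}. q ^ k - q ^ t)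
      = (\<Prod>t\<in>{dim M..<k}. q ^ n - q ^ t)"
    using card_avoiding[of "{0}" M k] assms by simp
  then show ?thesis
    unfolding num_above_def prod_dividef by (intro eq_divide_imp less_imp_neq[OF P, symmetric])
qed

lemma gaussian_eq_bracket: "k \<ge> 1 \<Longrightarrow> gaussian CARD('a) k 1 = bracket k"
  by (simp add: gaussian_def bracket_def flip: q_eq)

lemma gaussian_eq_num_above:
  assumes "2 \<le> k" "k \<le> n"
  shows "gaussian CARD('a) (n - 2) (k - 2) = num_above k 2"
proof -
  have "(q ^ (n - 2 - i) - 1) / (q ^ (k - 2 - i) - 1) = (q ^ n - q ^ (2 + i)) / (q ^ k - q ^ (2 + i))"
    if "i < k - 2" for i
  proof -
    have *: "q ^ n = q ^ (2 + i) * q ^ (n - 2 - i)" "q ^ k = q ^ (2 + i) * q ^ (k - 2 - i)"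
      unfolding power_add[symmetric] by (rule arg_cong[of _ _ "power q"], use that assms in simp)+
    have "(q ^ n - q ^ (2 + i)) / (q ^ k - q ^ (2 + i))
        = (q ^ (2 + i) * (q ^ (n - 2 - i) - 1)) / (q ^ (2 + i) * (q ^ (k - 2 - i) - 1))"
      unfolding * by (simp only: right_diff_distrib mult_1_right)
    then show ?thesis using q_ge_2 by simp
  qed
  then have "num_above k 2 = (\<Prod>i<k - 2. (q ^ (n - 2 - i) - 1) / (q ^ (k - 2 - i) - 1))"
    unfolding num_above_def prod.atLeastLessThan_shift_0[of _ 2] lessThan_atLeast0
    by (intro prod.cong) auto
  then show ?thesis using assms by (simp add: gaussian_def q_eq)
qed

text \<open>Every point contains exactly \<open>q - 1\<close> nonzero vectors, and each of them spans it.\<close>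

lemma sum_points:
  fixes f :: "'v set \<Rightarrow> real"
  assumes S: "subspace S"
  shows "(\<Sum>v\<in>S - {0}. f (span {v})) = (q - 1) * (\<Sum>x\<in>Gr scale 1 S. f x)"
proof -
  have "span {v} \<in> Gr scale 1 S" if "v \<in> S - {0}" for v
    using that span_minimal[of "{v}" S] S by (auto simp: Gr_iff)
  then have "(\<Sum>v\<in>S - {0}. f (span {v}))
      = (\<Sum>x\<in>Gr scale 1 S. \<Sum>v | v \<in> S - {0} \<and> span {v} = x. f (span {v}))"
    by (intro sum.group[symmetric]) auto
  also have "\<dots> = (\<Sum>x\<in>Gr scale 1 S. (q - 1) * f x)"
  proof (rule sum.cong)
    fix x assume x: "x \<in> Gr scale 1 S"
    have "span {v} = x" if "v \<in> x" "v \<noteq> 0" for v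
      using that x subspace_dim_equal[of "span {v}" x] span_minimal[of "{v}" x]
      by (auto simp: Gr_iff)
    then have "{v \<in> S - {0}. span {v} = x} = x - {0}"
      using x span_superset by (auto simp: Gr_iff)
    moreover have "real (card (x - {0})) = q - 1"
      using card_nonzero_vectors[of x] x by (simp add: Gr_iff)
    moreover have "(\<Sum>v | v \<in> S - {0} \<and> span {v} = x. f (span {v}))
        = (\<Sum>v | v \<in> S - {0} \<and> span {v} = x. f x)"
      by (rule sum.cong) auto
    ultimately show "(\<Sum>v | v \<in> S - {0} \<and> span {v} = x. f (span {v})) = (q - 1) * f x"
      by simp
  qed simp
  finally show ?thesis by (simp add: sum_distrib_left)
qed

lemma subspace_degree_eq:
  assumes "subspace S"
  shows "(q - 1) * real (subspace_degree scale \<F> S)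
       = (\<Sum>v\<in>S - {0}. real (point_degree \<F> (span {v})))"
  using sum_points[OF assms, of "\<lambda>x. real (point_degree \<F> x)"] by (simp add: subspace_degree_def)

text \<open>The number of \<open>k\<close>-spaces that avoid \<open>L\<close> and contain a given vector \<open>v\<close> outside \<open>L\<close> is the same
  for all \<open>v\<close>. So the average over the avoiding \<open>k\<close>-spaces of the sum of \<open>g\<close> is proportional to
  the sum of \<open>g\<close> outside \<open>L\<close>, and some \<open>S\<close> does not exceed this average.\<close>

lemma exists_avoiding_below_average:
  fixes g :: "'v \<Rightarrow> real"
  assumes L: "subspace L" and k: "1 \<le> k" and le: "dim L + k \<le> n"
  obtains S where "S \<in> avoiding k L {0}"
    and "(q ^ n - q ^ dim L) * (\<Sum>v\<in>S - {0}. g v) \<le> (q ^ k - 1) * (\<Sum>v\<in>UNIV - L. g v)"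
proof -
  let ?T = "avoiding k L {0}"
  let ?P = "\<Prod>t\<in>{1..<k}. q ^ k - q ^ t" and ?R = "\<Prod>t\<in>{1..<k}. q ^ n - q ^ (dim L + t)"
  have P: "?P > 0" by (intro prod_pos) (auto intro!: q_power_less)
  have T_ne: "?T \<noteq> {}" using L le by (intro avoiding_nonempty) auto
  have fin: "finite ?T" by (simp add: avoiding_def)
  have L0: "0 \<in> L" using L by (rule subspace_0)
  have thru: "real (card {S \<in> ?T. v \<in> S}) = ?R / ?P" if v: "v \<notin> L" for v
  proof -
    have v0: "v \<noteq> 0" using v L0 by blast
    have "span {v} \<inter> L \<subseteq> {0}"
    proof
      fix x assume x: "x \<in> span {v} \<inter> L"
      then obtain c where c: "x = scale c v" by (auto simp: span_singleton)
      have "c = 0"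
      proof (rule ccontr)
        assume "c \<noteq> 0"
        then show False using subspace_scale[OF L, of x "inverse c"] x c v by simp
      qed
      then show "x \<in> {0}" using c by simp
    qed
    moreover have "{S \<in> ?T. v \<in> S} = avoiding k L (span {v})"
      using span_insert_subset_iff[of "{0}" _ v] subspace_0
      by (simp add: avoiding_def Gr_iff insert_commute) blast
    ultimately have "real (card {S \<in> ?T. v \<in> S}) * ?P = ?R"
      using card_avoiding[OF L subspace_span, of "{v}" k] k v0 by simp
    then show ?thesis by (intro eq_divide_imp less_imp_neq[OF P, symmetric])
  qed
  have "real (card ?T) * ((q ^ k - 1) * ?P) = (q ^ n - q ^ dim L) * ?R"
    using card_avoiding[OF L, of "{0}" k] k by (simp add: prod.atLeast_Suc_lessThan)
  then have "real (card ?T) * (q ^ k - 1) = (q ^ n - q ^ dim L) * ?R / ?P"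
    by (intro eq_divide_imp less_imp_neq[OF P, symmetric]) (simp only: mult.assoc)
  then have card_T: "real (card ?T) * (q ^ k - 1) = (q ^ n - q ^ dim L) * (?R / ?P)"
    by (simp only: times_divide_eq_right)
  have sum_T: "(\<Sum>S\<in>?T. \<Sum>v\<in>S - {0}. g v) = ?R / ?P * (\<Sum>v\<in>UNIV - L. g v)"
  proof -
    have "(\<Sum>S\<in>?T. \<Sum>v\<in>S - {0}. g v) = (\<Sum>S\<in>?T. \<Sum>v | v \<in> UNIV - L \<and> v \<in> S. g v)"
      by (intro sum.cong) (use L0 in \<open>auto simp: avoiding_def\<close>)
    also have "\<dots> = (\<Sum>v\<in>UNIV - L. \<Sum>S | S \<in> ?T \<and> v \<in> S. g v)"
      by (rule sum.swap_restrict) (auto simp: fin)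
    also have "\<dots> = (\<Sum>v\<in>UNIV - L. ?R / ?P * g v)"
      by (intro sum.cong) (auto simp: thru)
    finally show ?thesis by (simp add: sum_distrib_left)
  qed
  have "\<exists>S\<in>?T. (q ^ n - q ^ dim L) * (\<Sum>v\<in>S - {0}. g v) \<le> (q ^ k - 1) * (\<Sum>v\<in>UNIV - L. g v)"
  proof (rule ccontr)
    assume "\<not> ?thesis"
    then have "(\<Sum>S\<in>?T. (q ^ k - 1) * (\<Sum>v\<in>UNIV - L. g v))
        < (\<Sum>S\<in>?T. (q ^ n - q ^ dim L) * (\<Sum>v\<in>S - {0}. g v))"
      using fin T_ne by (intro sum_strict_mono) (auto simp: not_le)
    also have "\<dots> = (q ^ n - q ^ dim L) * (?R / ?P) * (\<Sum>v\<in>UNIV - L. g v)"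
      unfolding sum_distrib_left[symmetric] sum_T by simp
    finally show False unfolding card_T[symmetric] by simp
  qed
  then show ?thesis using that by blast
qed

text \<open>Every member above \<open>M\<close> contains at least \<open>q - 1\<close> vectors of \<open>C\<close>, hence lies above
  \<open>span (insert v M)\<close> for at least \<open>q - 1\<close> choices of \<open>v \<in> C\<close>. Here \<open>C\<close> is any set of vectors rather
  than a subspace so that it can also be a difference of two subspaces.\<close>

lemma degree_branch:
  assumes G: "\<And>F. F \<in> \<G> \<Longrightarrow> subspace F"
    and hit: "\<And>F. F \<in> \<G> \<Longrightarrow> M \<subseteq> F \<Longrightarrow> \<exists>w\<in>F. w \<noteq> 0 \<and> span {w} - {0} \<subseteq> C"
    and M: "subspace M"
    and bound: "\<And>v. v \<in> C \<Longrightarrow> real (point_degree \<G> (span (insert v M))) \<le> b"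
  shows "(q - 1) * real (point_degree \<G> M) \<le> real (card C) * b"
proof -
  let ?H = "{F \<in> \<G>. M \<subseteq> F}"
  have fin: "finite ?H" by (rule finite_subset[of _ UNIV]) (auto simp: Finite_Set.finite_set)
  have one: "q - 1 \<le> real (card {v \<in> C. v \<in> F})" if F: "F \<in> ?H" for F
  proof -
    obtain w where w: "w \<in> F" "w \<noteq> 0" "span {w} - {0} \<subseteq> C" using hit F by blast
    have "span {w} \<subseteq> F" using span_minimal[of "{w}" F] w G F by blast
    then have "card (span {w} - {0}) \<le> card {v \<in> C. v \<in> F}"
      using w by (intro card_mono) auto
    moreover have "real (card (span {w} - {0})) = q - 1"
      unfolding card_nonzero_vectors[OF subspace_span] using w by simp
    ultimately show ?thesis by simp
  qed
  have "(q - 1) * real (point_degree \<G> M) = (\<Sum>F\<in>?H. q - 1)"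
    by (simp add: point_degree_def)
  also have "\<dots> \<le> (\<Sum>F\<in>?H. real (card {v \<in> C. v \<in> F}))"
    by (rule sum_mono) (rule one)
  also have "\<dots> = real (\<Sum>v\<in>C. card {F \<in> ?H. v \<in> F})"
    using sum_multicount_gen[OF fin, of C "\<lambda>F v. v \<in> F" "\<lambda>v. card {F \<in> ?H. v \<in> F}"]
    unfolding of_nat_sum[symmetric] by simp
  also have "(\<Sum>v\<in>C. card {F \<in> ?H. v \<in> F}) = (\<Sum>v\<in>C. point_degree \<G> (span (insert v M)))"
  proof (rule sum.cong)
    fix v
    have "{F \<in> ?H. v \<in> F} = {F \<in> \<G>. span (insert v M) \<subseteq> F}"
      using span_insert_subset_iff[OF M] G by blast
    then show "card {F \<in> ?H. v \<in> F} = point_degree \<G> (span (insert v M))"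
      by (simp add: point_degree_def)
  qed simp
  also have "real \<dots> \<le> (\<Sum>v\<in>C. b)"
    unfolding of_nat_sum by (rule sum_mono) (rule bound)
  finally show ?thesis by simp
qed

lemma degree_branch_subspace:
  assumes G: "\<And>F. F \<in> \<G> \<Longrightarrow> subspace F"
    and U: "subspace U" and hit: "\<And>F. F \<in> \<G> \<Longrightarrow> \<not> U \<inter> F \<subseteq> {0}"
    and M: "subspace M"
    and bound: "\<And>v. v \<in> U \<Longrightarrow> v \<noteq> 0 \<Longrightarrow> real (point_degree \<G> (span (insert v M))) \<le> b"
  shows "real (point_degree \<G> M) \<le> bracket (dim U) * b"
proof -
  have "\<exists>w\<in>F. w \<noteq> 0 \<and> span {w} - {0} \<subseteq> U - {0}" if F: "F \<in> \<G>" for F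
  proof -
    obtain w where "w \<in> U" "w \<in> F" "w \<noteq> 0" using hit[OF F] by blast
    then show ?thesis using span_minimal[of "{w}" U] U by blast
  qed
  then have "(q - 1) * real (point_degree \<G> M) \<le> real (card (U - {0})) * b"
    using G M bound by (intro degree_branch) auto
  also have "real (card (U - {0})) = (q - 1) * bracket (dim U)"
    using card_nonzero_vectors[OF U] by (simp add: bracket_mult)
  finally show ?thesis using q_ge_2 by (simp add: mult.assoc)
qed

end

section \<open>The size of an intersecting family without a centre\<close>

locale centreless_intersecting_family = finite_field_space scale Basis q n
  for scale :: "'a::{field,finite} \<Rightarrow> 'v::ab_group_add \<Rightarrow> 'v"
    and Basis :: "'v set" and q :: real and n :: nat +
  fixes k :: nat and \<F> :: "'v set set"
  assumes family: "\<F> \<subseteq> Gr scale k UNIV"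
    and meet: "A \<in> \<F> \<Longrightarrow> B \<in> \<F> \<Longrightarrow> \<not> A \<inter> B \<subseteq> {0}"
    and k_ge_2: "k \<ge> 2"
    and n_ge: "n \<ge> 2 * k + 1"
    and no_centre: "v \<noteq> 0 \<Longrightarrow> \<exists>A\<in>\<F>. v \<notin> A"
begin

lemma member: "A \<in> \<F> \<Longrightarrow> subspace A" "A \<in> \<F> \<Longrightarrow> dim A = k"
  using family by (auto simp: Gr_iff)

lemma finite_family [simp]: "finite \<F>"
  by (rule finite_subset[OF family]) simp

lemma nonempty: "\<F> \<noteq> {}"
proof -
  have "dim (UNIV :: 'v set) \<noteq> 0" using n_ge by simp
  then obtain v :: 'v where "v \<noteq> 0" by (metis dim_eq_0 insertI1 subsetI)
  then show ?thesis using no_centre by blast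
qed

lemma degree_le_num_above:
  assumes "\<G> \<subseteq> \<F>" "subspace M" "dim M \<le> k"
  shows "real (point_degree \<G> M) \<le> num_above k (dim M)"
proof -
  have "point_degree \<G> M \<le> card {S \<in> Gr scale k UNIV. M \<subseteq> S}"
    unfolding point_degree_def using assms(1) family by (intro card_mono) auto
  then show ?thesis using card_above[OF assms(2,3)] by simp
qed

lemma card_eq_degree_0: "\<G> \<subseteq> \<F> \<Longrightarrow> card \<G> = point_degree \<G> {0}"
  using member subspace_0 unfolding point_degree_def by (intro arg_cong[of _ _ card]) auto

text \<open>The subspaces that may serve as the set of branches: every member meets them.\<close>

definition cover :: "'v set \<Rightarrow> bool" where
  "cover U \<longleftrightarrow> subspace U \<and> (\<forall>A\<in>\<F>. \<not> U \<inter> A \<subseteq> {0})"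

lemma cover_member: "A \<in> \<F> \<Longrightarrow> cover A"
  using member meet by (auto simp: cover_def)

text \<open>A cover consisting of one point would be a common point of all members.\<close>

lemma cover_dim_ge_2: "cover U \<Longrightarrow> dim U \<ge> 2"
proof (rule ccontr)
  assume U: "cover U" and "\<not> dim U \<ge> 2"
  then have d: "dim U \<le> 1" and sU: "subspace U" by (auto simp: cover_def)
  obtain A where "A \<in> \<F>" using nonempty by blast
  then obtain v where v: "v \<in> U" "v \<noteq> 0" using U by (auto simp: cover_def)
  obtain B where B: "B \<in> \<F>" "v \<notin> B" using no_centre v by blast
  obtain w where w: "w \<in> U" "w \<in> B" "w \<noteq> 0" using U B by (auto simp: cover_def)
  have "span {w} = U"
    using subspace_dim_equal[of "span {w}" U] span_minimal[of "{w}" U] w sU d by simp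
  then have "U \<subseteq> B" using span_minimal[of "{w}" B] w B member by blast
  then show False using v B by blast
qed

text \<open>A subspace inside a member of \<open>\<G>\<close> and of dimension less than \<open>t\<close> is not a cover, so it misses
  some member of \<open>\<F>\<close>; branching over the points of that member raises the dimension by one at the
  cost of a factor \<open>[k]\<close>. Taking a subfamily \<open>\<G>\<close> weakens the condition \<open>escape\<close>, and this is
  what allows longer chains for the members that do not contain \<open>X\<close> below.\<close>

lemma degree_le_chain:
  assumes G: "\<G> \<subseteq> \<F>" and t: "t \<le> k"
    and escape: "\<And>M A. subspace M \<Longrightarrow> dim M < t \<Longrightarrow> A \<in> \<G> \<Longrightarrow> M \<subseteq> A \<Longrightarrow> \<not> cover M"
    and M: "subspace M" "dim M \<le> t"
  shows "real (point_degree \<G> M) \<le> bracket k ^ (t - dim M) * num_above k t"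
  using M
proof (induction "t - dim M" arbitrary: M)
  case 0
  then show ?case using degree_le_num_above[OF G, of M] t by simp
next
  case (Suc d)
  show ?case
  proof (cases "\<exists>A\<in>\<G>. M \<subseteq> A")
    case False
    then have "{A \<in> \<G>. M \<subseteq> A} = {}" by blast
    then have "point_degree \<G> M = 0" unfolding point_degree_def by (simp only: card.empty)
    moreover have "num_above k t > 0" using n_ge by (intro num_above_pos) simp
    ultimately show ?thesis by simp
  next
    case True
    moreover have "dim M < t" using Suc.hyps(2) by simp
    ultimately have "\<not> cover M" using escape[OF Suc.prems(1)] by blast
    then obtain B where B: "B \<in> \<F>" "M \<inter> B \<subseteq> {0}"
      using Suc.prems(1) by (auto simp: cover_def)
    have bound: "real (point_degree \<G> (span (insert v M))) \<le> bracket k ^ d * num_above k t"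
      if v: "v \<in> B" "v \<noteq> 0" for v
    proof -
      have "dim (span (insert v M)) = dim M + 1"
        using v B Suc.prems by (intro dim_span_insert) auto
      moreover have "d = t - (dim M + 1)" "dim M + 1 \<le> t" using Suc.hyps(2) by auto
      ultimately show ?thesis
        using Suc.hyps(1)[of "span (insert v M)"] by (simp del: dim_span)
    qed
    have "real (point_degree \<G> M) \<le> bracket (dim B) * (bracket k ^ d * num_above k t)"
    proof (rule degree_branch_subspace[OF _ _ _ Suc.prems(1) bound])
      show "subspace A" if "A \<in> \<G>" for A using that G member by blast
      show "subspace B" using B member by blast
      show "\<not> B \<inter> A \<subseteq> {0}" if "A \<in> \<G>" for A using that G meet B by blast
    qed
    then show ?thesis using member(2)[OF B(1)] Suc.hyps(2)[symmetric] by (simp add: mult.assoc)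
  qed
qed

lemma q_power_n: "q ^ n \<ge> q * q ^ k * q ^ k"
proof -
  have "q * q ^ k * q ^ k = q ^ (2 * k + 1)" by (simp add: power_add mult_2)
  also have "\<dots> \<le> q ^ n" using n_ge by (rule q_power_le)
  finally show ?thesis .
qed

text \<open>The hypothesis \<open>n \<ge> 2k + 1\<close> gives \<open>q [k] [k-j] \<le> [n-j]\<close>, while
  \<open>[k-j] N_j = [n-j] N_(j+1)\<close>.\<close>

lemma num_above_step:
  assumes "j < k"
  shows "bracket k * num_above k (Suc j) \<le> num_above k j / q"
proof -
  define a b where "a = q ^ k" and "b = q ^ j"
  have ab: "1 \<le> b" "b < a" using q_power_le[of 0 j] q_power_less[OF assms] by (auto simp: a_def b_def)
  have q: "q \<ge> 2" by (rule q_ge_2)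
  have "(q - 1) * (q * bracket k * (a - b)) = q * (a - 1) * (a - b)"
    using bracket_mult[of k] by (simp add: a_def)
  also have "\<dots> \<le> q * (a * a) - b"
  proof -
    define c where "c = a * b + a - b"
    have "1 * b \<le> a * b" using ab by (intro mult_right_mono) auto
    then have c: "b \<le> c" "0 \<le> c" unfolding c_def using ab by linarith+
    then have "b \<le> q * c" using q mult_right_mono[of 1 q c] by simp
    then show ?thesis by (simp add: c_def algebra_simps)
  qed
  also have "\<dots> \<le> (q - 1) * (q * (a * a) - b)"
  proof -
    have "b * 1 \<le> a * a" using ab by (intro mult_mono) auto
    moreover have "a * a \<le> q * (a * a)" using q mult_right_mono[of 1 q "a * a"] by simp
    ultimately show ?thesis using q mult_right_mono[of 1 "q - 1" "q * (a * a) - b"] by simp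
  qed
  also have "\<dots> \<le> (q - 1) * (q ^ n - b)"
    using q_power_n q by (intro mult_left_mono) (auto simp: a_def mult.assoc)
  finally have key: "q * bracket k * (a - b) \<le> q ^ n - b"
    using q by simp
  have N: "num_above k (Suc j) > 0" using n_ge by (intro num_above_pos) simp
  have "(q * (bracket k * num_above k (Suc j))) * (a - b) \<le> (q ^ n - b) * num_above k (Suc j)"
    using mult_right_mono[OF key, of "num_above k (Suc j)"] N by (simp add: algebra_simps)
  also have "\<dots> = num_above k j * (a - b)"
    using num_above_Suc[OF assms] by (simp add: a_def b_def mult.commute)
  finally have "q * (bracket k * num_above k (Suc j)) \<le> num_above k j"
    using ab by simp
  then show ?thesis using q by (simp add: field_simps)
qed

text \<open>In the last step the gain is better by a further factor \<open>q\<close>, since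
  \<open>q^2 [k] \<le> [k+2] \<le> [n-k+1]\<close>.\<close>

lemma num_above_last_step: "bracket k * num_above k k \<le> num_above k (k - 1) / q ^ 2"
proof -
  define b where "b = q ^ (k - 1)"
  have a: "q ^ k = q * b" using k_ge_2 by (simp add: b_def power_eq_if)
  have q: "q \<ge> 2" by (rule q_ge_2)
  have b: "b \<ge> 1" using q_power_le[of 0 "k - 1"] by (simp add: b_def)
  have "q ^ k - b = (q - 1) * b" by (simp add: a algebra_simps)
  then have "bracket k * q ^ 2 * (q ^ k - b) = q ^ 2 * b * ((q - 1) * bracket k)" by simp
  also have "\<dots> = q ^ 2 * b * (q * b - 1)" by (simp only: bracket_mult a)
  also have "\<dots> \<le> q * (q * b) * (q * b) - b"
  proof -
    have "b * 1 \<le> b * q ^ 2" using q b by (intro mult_left_mono) auto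
    then show ?thesis by (simp add: algebra_simps power2_eq_square)
  qed
  also have "\<dots> \<le> q ^ n - b" using q_power_n by (simp add: a)
  also have "\<dots> = (q ^ k - b) * num_above k (k - 1)"
    using num_above_Suc[of "k - 1" k] k_ge_2 by (simp add: b_def)
  finally have "bracket k * q ^ 2 * (q ^ k - b) \<le> num_above k (k - 1) * (q ^ k - b)"
    by (simp add: mult.commute)
  moreover have "q ^ k - b > 0" using q b by (simp add: a)
  ultimately have "bracket k * q ^ 2 \<le> num_above k (k - 1)" by simp
  then show ?thesis using q by (simp add: field_simps)
qed

lemma num_above_steps:
  assumes "2 \<le> l" "l \<le> k"
  shows "bracket k ^ (l - 1) * num_above k l \<le> bracket k * num_above k 2 / q ^ (l - 2)"
  using assms
proof (induction l rule: dec_induct)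
  case base
  then show ?case by simp
next
  case (step j)
  have q: "q > 0" using q_ge_2 by simp
  have "bracket k ^ (Suc j - 1) * num_above k (Suc j)
      = bracket k ^ (j - 1) * (bracket k * num_above k (Suc j))"
    using step.hyps by (simp add: power_eq_if)
  also have "\<dots> \<le> bracket k ^ (j - 1) * (num_above k j / q)"
    using step by (intro mult_left_mono num_above_step) auto
  also have "\<dots> = (bracket k ^ (j - 1) * num_above k j) / q" by simp
  also have "\<dots> \<le> (bracket k * num_above k 2 / q ^ (j - 2)) / q"
    using step q by (intro divide_right_mono) auto
  also have "\<dots> = bracket k * num_above k 2 / q ^ (Suc j - 2)"
  proof -
    have "Suc j - 2 = Suc (j - 2)" using step.hyps by simp
    then show ?thesis by simp
  qed
  finally show ?case .
qed

lemma bracket_Suc_le: "bracket (Suc m) \<le> 2 * q ^ m - 1"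
proof (induction m)
  case (Suc m)
  have "q * bracket (Suc m) \<le> q * (2 * q ^ m - 1)"
    using Suc q_ge_2 by (intro mult_left_mono) auto
  then show ?case using q_ge_2 by (simp add: bracket_Suc[of "Suc m"] algebra_simps)
qed simp

lemma card_family_le_power:
  assumes "\<And>U. cover U \<Longrightarrow> dim U \<ge> k"
  shows "real (card \<F>) \<le> bracket k ^ k"
proof -
  have "real (point_degree \<F> {0}) \<le> bracket k ^ (k - dim {0}) * num_above k k"
    using assms by (intro degree_le_chain) (auto simp: not_le dest: leD)
  then show ?thesis using card_eq_degree_0[of \<F>] by simp
qed

lemma bracket_mono: "i \<le> j \<Longrightarrow> bracket i \<le> bracket j"
  using q_power_le q_ge_2 by (simp add: bracket_def divide_right_mono)

text \<open>With \<open>K = [k]\<close>, \<open>a = dim X\<close> and \<open>B = K^(l-1) N_l\<close>, the members are split by their position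
  relative to \<open>X\<close>. Those with \<open>A \<inter> X = 0\<close> meet \<open>L\<close> in points outside \<open>X\<close> and number at most
  \<open>([l] - [a]) B / q\<close>. Those containing \<open>X\<close> number at most \<open>K^(l-a) N_l\<close>. The others meet \<open>X\<close> in
  some point and number at most \<open>[a] B / q\<close>; there are none when \<open>a = 1\<close>. In each of the cases
  \<open>a = 0\<close>, \<open>a = 1\<close> and \<open>a \<ge> 2\<close> the sum is at most
  \<open>B (([l] - 1) / q + 1) = B ([l-1] + 1) \<le> 2 q^(l-2) B \<le> 2 K N_2\<close>.\<close>

lemma card_family_le_small_cover:
  assumes L: "cover L" and least: "\<And>U. cover U \<Longrightarrow> dim L \<le> dim U" and Lk: "dim L < k"
  shows "real (card \<F>) \<le> 2 * bracket k * num_above k 2"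
proof -
  define l where "l = dim L"
  define X where "X = \<Inter>{U. cover U \<and> dim U < k}"
  define a where "a = dim X"
  define K where "K = bracket k"
  define B where "B = K ^ (l - 1) * num_above k l"
  have sL: "subspace L" using L by (simp add: cover_def)
  have sX: "subspace X" unfolding X_def by (rule subspace_Inter) (auto simp: cover_def)
  have XL: "X \<subseteq> L" using L Lk by (auto simp: X_def)
  have l: "2 \<le> l" "l < k" using cover_dim_ge_2[OF L] Lk by (auto simp: l_def)
  have q: "q \<ge> 2" by (rule q_ge_2)
  have Npos: "num_above k j > 0" for j using n_ge by (intro num_above_pos) simp
  have K1: "K \<ge> 3"
  proof -
    have "bracket 2 \<le> K" unfolding K_def using k_ge_2 by (rule bracket_mono)
    then show ?thesis using q by (simp add: numeral_2_eq_2 bracket_Suc)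
  qed
  have Bpos: "B > 0" using K1 Npos by (simp add: B_def)
  have B_eq: "K * (K ^ (l - 2) * num_above k l) = B"
  proof -
    have "l - 1 = Suc (l - 2)" using l by simp
    then show ?thesis by (simp add: B_def)
  qed
  have chain: "real (point_degree \<G> M) \<le> K ^ (l - dim M) * num_above k l"
    if "\<G> \<subseteq> \<F>" "subspace M" "dim M \<le> l" for \<G> M
    unfolding K_def using that l least by (intro degree_le_chain) (auto simp: l_def not_le dest: leD)

  define \<F>1 where "\<F>1 = {A \<in> \<F>. A \<inter> X \<subseteq> {0}}"
  define \<F>2 where "\<F>2 = {A \<in> \<F>. X \<subseteq> A}"
  define \<F>3 where "\<F>3 = {A \<in> \<F>. \<not> X \<subseteq> A \<and> \<not> A \<inter> X \<subseteq> {0}}"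
  have sub: "\<F>1 \<subseteq> \<F>" "\<F>2 \<subseteq> \<F>" "\<F>3 \<subseteq> \<F>" by (auto simp: \<F>1_def \<F>2_def \<F>3_def)

  have c1: "real (card \<F>1) \<le> (bracket l - bracket a) * (B / q)"
  proof -
    let ?b = "bracket (k - 1) * (K ^ (l - 2) * num_above k l)"
    have "(q - 1) * real (point_degree \<F>1 {0}) \<le> real (card (L - X)) * ?b"
    proof (rule degree_branch)
      show "subspace A" if "A \<in> \<F>1" for A using that sub member by blast
      show "\<exists>w\<in>A. w \<noteq> 0 \<and> span {w} - {0} \<subseteq> L - X" if A: "A \<in> \<F>1" for A
      proof -
        have "\<not> L \<inter> A \<subseteq> {0}" using L A sub(1) unfolding cover_def by blast
        then obtain w where w: "w \<in> L" "w \<in> A" "w \<noteq> 0" by blast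
        have "span {w} \<subseteq> L" using w sL by (intro span_minimal) auto
        moreover have "subspace A" using A sub(1) member by blast
        then have "span {w} \<subseteq> A" using w by (intro span_minimal) auto
        ultimately show ?thesis using w A by (auto simp: \<F>1_def)
      qed
      show "real (point_degree \<F>1 (span (insert v {0}))) \<le> ?b" if v: "v \<in> L - X" for v
      proof -
        \<comment> \<open>Branching over \<open>U\<close> instead of a member costs only a factor \<open>[k-1]\<close>.\<close>
        obtain U where U: "cover U" "dim U < k" "v \<notin> U" using v by (auto simp: X_def)
        have v0: "v \<noteq> 0" using v sX subspace_0 by blast
        have "real (point_degree \<F>1 (span {v})) \<le> bracket (dim U) * (K ^ (l - 2) * num_above k l)"
        proof (rule degree_branch_subspace)
          show "subspace A" if "A \<in> \<F>1" for A using that sub member by blast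
          show "subspace U" using U by (simp add: cover_def)
          show "\<not> U \<inter> A \<subseteq> {0}" if "A \<in> \<F>1" for A using that U(1) sub(1) unfolding cover_def by blast
          show "subspace (span {v})" by simp
          show "real (point_degree \<F>1 (span (insert w (span {v})))) \<le> K ^ (l - 2) * num_above k l"
            if w: "w \<in> U" "w \<noteq> 0" for w
          proof -
            have "w \<notin> span {v}"
            proof
              assume "w \<in> span {v}"
              then obtain c where c: "w = scale c v" by (auto simp: span_singleton)
              then have "c \<noteq> 0" using w by auto
              then show False
                using subspace_scale[of U w "inverse c"] U w c by (auto simp: cover_def)
            qed
            then have "dim (span (insert w (span {v}))) = 2"
              using dim_span_insert[of "span {v}" w] v0 by simp
            then show ?thesis
              using chain[OF sub(1), of "span (insert w (span {v}))"] l by (simp del: dim_span)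
          qed
        qed
        also have "\<dots> \<le> ?b"
          using U l K1 Npos[of l] by (intro mult_right_mono bracket_mono) auto
        finally show ?thesis by (simp add: insert_commute)
      qed
    qed simp
    then have "(q - 1) * real (card \<F>1) \<le> (q ^ l - q ^ a) * ?b"
      using card_eq_degree_0[OF sub(1)] card_subspace_diff[OF sX sL XL] by (simp add: l_def a_def)
    also have "q ^ l - q ^ a = (q - 1) * (bracket l - bracket a)"
      by (simp add: right_diff_distrib bracket_mult)
    finally have "real (card \<F>1) \<le> (bracket l - bracket a) * ?b"
      using q by (simp add: mult.assoc)
    also have "\<dots> \<le> (bracket l - bracket a) * (B / q)"
    proof (rule mult_left_mono)
      have "K = q * bracket (k - 1) + 1" using bracket_Suc[of "k - 1"] l by (simp add: K_def)
      then have "bracket (k - 1) \<le> K / q" using q by (simp add: field_simps)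
      then have "?b \<le> K / q * (K ^ (l - 2) * num_above k l)"
        using K1 Npos[of l] by (intro mult_right_mono) auto
      then show "?b \<le> B / q" using B_eq by simp
      show "0 \<le> bracket l - bracket a"
        using bracket_mono[of a l] dim_subset[OF XL] by (simp add: a_def l_def)
    qed
    finally show ?thesis .
  qed

  have c2: "real (card \<F>2) \<le> K ^ (l - a) * num_above k l"
  proof -
    have "card \<F>2 = point_degree \<F> X" by (simp add: \<F>2_def point_degree_def)
    then show ?thesis
      using chain[OF subset_refl sX] dim_subset[OF XL] by (simp add: a_def l_def)
  qed

  have c3: "real (card \<F>3) \<le> bracket a * (B / q)"
  proof -
    have "real (point_degree \<F>3 {0}) \<le> bracket (dim X) * (K ^ l * num_above k (Suc l))"
    proof (rule degree_branch_subspace[OF _ sX])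
      show "subspace A" if "A \<in> \<F>3" for A using that sub member by blast
      show "\<not> X \<inter> A \<subseteq> {0}" if "A \<in> \<F>3" for A using that by (auto simp: \<F>3_def)
      show "real (point_degree \<F>3 (span (insert v {0}))) \<le> K ^ l * num_above k (Suc l)"
        if v: "v \<in> X" "v \<noteq> 0" for v
      proof -
        \<comment> \<open>A cover of dimension at most \<open>l < k\<close> contains \<open>X\<close>, but a member of \<open>\<F>3\<close> does not.\<close>
        have "\<not> cover M" if "dim M < Suc l" "A \<in> \<F>3" "M \<subseteq> A" for M A
          using that l by (auto simp: X_def \<F>3_def)
        then have "real (point_degree \<F>3 (span {v}))
            \<le> bracket k ^ (Suc l - dim (span {v})) * num_above k (Suc l)"
          using l v by (intro degree_le_chain[OF sub(3)]) auto
        then show ?thesis using v by (simp add: insert_commute K_def)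
      qed
    qed simp
    also have "\<dots> \<le> bracket a * (B / q)"
    proof -
      have "K ^ l = K ^ (l - 1) * K" using l by (simp add: power_eq_if)
      then have "K ^ l * num_above k (Suc l) = K ^ (l - 1) * (K * num_above k (Suc l))" by simp
      also have "\<dots> \<le> K ^ (l - 1) * (num_above k l / q)"
        unfolding K_def using l by (intro mult_left_mono num_above_step) auto
      finally show ?thesis unfolding a_def B_def by (intro mult_left_mono) auto
    qed
    finally show ?thesis using card_eq_degree_0[OF sub(3)] by simp
  qed

  have "real (card \<F>) \<le> B * ((bracket l - 1) / q + 1)"
  proof -
    have "card \<F> \<le> card \<F>1 + card \<F>2 + card \<F>3"
    proof -
      have "\<F> = \<F>1 \<union> \<F>2 \<union> \<F>3" by (auto simp: \<F>1_def \<F>2_def \<F>3_def)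
      then show ?thesis by (metis card_Un_le add_le_mono1 order_trans)
    qed
    then have total: "real (card \<F>) \<le> real (card \<F>1) + real (card \<F>2) + real (card \<F>3)"
      by linarith
    consider "a = 0" | "a = 1" | "a \<ge> 2" by linarith
    then show ?thesis
    proof cases
      case 1
      then have "\<F>1 = \<F>" by (auto simp: \<F>1_def a_def)
      then have "real (card \<F>) \<le> bracket l * (B / q)" using c1 1 by simp
      also have "\<dots> = B * ((bracket l - 1) / q + 1 / q)" by (simp flip: add_divide_distrib)
      also have "\<dots> \<le> B * ((bracket l - 1) / q + 1)"
        using Bpos q by (intro mult_left_mono) auto
      finally show ?thesis .
    next
      case 2
      have "\<F>3 = {}"
      proof (rule ccontr)
        assume "\<F>3 \<noteq> {}"
        then obtain A w where A: "A \<in> \<F>3" "w \<in> A" "w \<in> X" "w \<noteq> 0" by (auto simp: \<F>3_def)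
        have "span {w} = X"
          using subspace_dim_equal[of "span {w}" X] span_minimal[of "{w}" X] A sX 2
          by (simp add: a_def)
        then have "X \<subseteq> A" using span_minimal[of "{w}" A] A sub member by blast
        then show False using A by (simp add: \<F>3_def)
      qed
      then have "real (card \<F>) \<le> (bracket l - 1) * (B / q) + B"
        using total c1 c2 2 by (simp add: B_def)
      also have "\<dots> = B * ((bracket l - 1) / q + 1)" by (simp add: field_simps)
      finally show ?thesis .
    next
      case 3
      \<comment> \<open>The first and the third class add up to \<open>[l] B / q\<close>, so the second may have up to
          \<open>B (1 - 1 / q)\<close> members; it has at most \<open>B / K\<close>.\<close>
      have "K ^ (l - a) * num_above k l \<le> K ^ (l - 2) * num_above k l"
        using 3 K1 Npos[of l] by (intro mult_right_mono power_increasing) auto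
      also have "\<dots> = B / K" using B_eq K1 by (simp add: field_simps)
      also have "\<dots> \<le> B * (1 - 1 / q)"
      proof -
        have "1 / K \<le> 1 / 3" "1 / q \<le> 1 / 2" using K1 q by (auto intro!: divide_left_mono)
        then have "1 / K \<le> 1 - 1 / q" by linarith
        then have "B * (1 / K) \<le> B * (1 - 1 / q)" using Bpos by (intro mult_left_mono) auto
        then show ?thesis by simp
      qed
      finally have "real (card \<F>)
          \<le> (bracket l - bracket a) * (B / q) + B * (1 - 1 / q) + bracket a * (B / q)"
        using total c1 c2 c3 by linarith
      also have "\<dots> = B * ((bracket l - 1) / q + 1)" using q by (simp add: field_simps)
      finally show ?thesis .
    qed
  qed
  also have "\<dots> = B * (bracket (l - 1) + 1)"
    using bracket_Suc[of "l - 1"] l q by simp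
  also have "\<dots> \<le> B * (2 * q ^ (l - 2))"
  proof (rule mult_left_mono)
    have "l - 1 = Suc (l - 2)" using l by simp
    then show "bracket (l - 1) + 1 \<le> 2 * q ^ (l - 2)" using bracket_Suc_le[of "l - 2"] by simp
  qed (use Bpos in simp)
  also have "\<dots> \<le> (K * num_above k 2 / q ^ (l - 2)) * (2 * q ^ (l - 2))"
    unfolding B_def K_def using l q by (intro mult_right_mono num_above_steps) auto
  also have "\<dots> = 2 * bracket k * num_above k 2" using q by (simp add: K_def)
  finally show ?thesis .
qed

text \<open>If the smallest covers have dimension \<open>k\<close>, the chain runs up to the members themselves and gives
  \<open>|\<F>| \<le> [k]^k\<close>. The \<open>k - 3\<close> middle steps gain a factor \<open>q\<close> each and the last one gains \<open>q^2\<close>;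
  together these outweigh the surplus factor \<open>[k] \<le> 2 q^(k-1)\<close>. The last step is beyond
  dimension \<open>2\<close> only for \<open>k \<ge> 3\<close>.\<close>

lemma card_family_le:
  assumes "k \<ge> 3"
  shows "real (card \<F>) \<le> 2 * bracket k * num_above k 2"
proof -
  obtain A where "A \<in> \<F>" using nonempty by blast
  then obtain L where L: "cover L" "\<And>U. cover U \<Longrightarrow> dim L \<le> dim U"
    using ex_has_least_nat[of cover A dim] cover_member by blast
  show ?thesis
  proof (cases "dim L < k")
    case True
    then show ?thesis using card_family_le_small_cover L by blast
  next
    case False
    define K where "K = bracket k"
    have q: "q > 0" using q_ge_2 by simp
    have "real (card \<F>) \<le> K ^ k"
      unfolding K_def using False L(2) by (intro card_family_le_power) (meson le_trans not_le)
    also have "K ^ k = K * (K ^ (k - 2) * K)"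
    proof -
      have "k = Suc (Suc (k - 2))" using assms by simp
      then have "K ^ k = K ^ Suc (Suc (k - 2))" by (rule arg_cong)
      then show ?thesis by (simp add: mult.commute mult.left_commute)
    qed
    also have "K * (K ^ (k - 2) * K) = K * (K ^ (k - 2) * (K * num_above k k))" by simp
    also have "\<dots> \<le> K * (K ^ (k - 2) * (num_above k (k - 1) / q ^ 2))"
      unfolding K_def by (intro mult_left_mono num_above_last_step) auto
    also have "\<dots> = K * (K ^ (k - 1 - 1) * num_above k (k - 1)) / q ^ 2"
      using assms by (simp add: numeral_2_eq_2)
    also have "\<dots> \<le> K * (K * num_above k 2 / q ^ (k - 1 - 2)) / q ^ 2"
      unfolding K_def using assms by (intro divide_right_mono mult_left_mono num_above_steps) auto
    also have "\<dots> = K / q ^ (k - 1) * (K * num_above k 2)"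
    proof -
      have "q ^ (k - 1) = q ^ (k - 1 - 2) * q ^ 2"
        using assms unfolding power_add[symmetric] by (intro arg_cong[of _ _ "power q"]) simp
      then show ?thesis by (simp add: mult.commute mult.left_commute)
    qed
    also have "\<dots> \<le> 2 * (K * num_above k 2)"
    proof (rule mult_right_mono)
      have "K \<le> 2 * q ^ (k - 1)"
        using bracket_Suc_le[of "k - 1"] assms by (simp add: K_def)
      then show "K / q ^ (k - 1) \<le> 2" using q by (simp add: field_simps)
      show "0 \<le> K * num_above k 2"
        unfolding K_def using n_ge by (intro mult_nonneg_nonneg less_imp_le[OF num_above_pos]) auto
    qed
    finally show ?thesis by (simp add: K_def)
  qed
qed

text \<open>For \<open>k = 2\<close> the crude bound \<open>|\<F>| \<le> [2]^2 = (q + 1)^2\<close> suffices, because \<open>n \<ge> 5\<close>;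
  for \<open>k \<ge> 3\<close> the claim reduces to \<open>2 [k] (q^k - q) < q^n - q^k\<close>.\<close>

lemma card_family_less: "real (card \<F>) * (q ^ k - q) < (q ^ n - q ^ k) * num_above k 2"
proof -
  have q: "q \<ge> 2" by (rule q_ge_2)
  have N: "num_above k 2 > 0" using n_ge by (intro num_above_pos) simp
  define a where "a = q ^ k"
  have qa: "q < a" using q_power_less[of 1 k] k_ge_2 by (simp add: a_def)
  show ?thesis
  proof (cases "k = 2")
    case True
    have K: "bracket 2 = q + 1" by (simp add: numeral_2_eq_2 bracket_Suc)
    have "real (card \<F>) \<le> (q + 1) ^ 2"
      using card_family_le_power cover_dim_ge_2 True K by metis
    then have "real (card \<F>) * (q ^ 2 - q) \<le> (q + 1) ^ 2 * (q ^ 2 - q)"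
      using qa True by (intro mult_right_mono) (auto simp: a_def)
    also have "\<dots> = q ^ 4 + q ^ 3 - q ^ 2 - q" by algebra
    also have "\<dots> < q * q ^ 4 - q ^ 2"
    proof -
      have "q * q ^ 3 \<ge> 2 * q ^ 3" "q * q ^ 4 \<ge> 2 * q ^ 4" using q by (auto intro!: mult_right_mono)
      moreover have "q * q ^ 3 = q ^ 4" by algebra
      moreover have "q ^ 3 > 0" using q by simp
      ultimately show ?thesis using q by linarith
    qed
    also have "\<dots> \<le> q ^ n - q ^ 2"
    proof -
      have "q * q ^ 4 = q * q ^ k * q ^ k" unfolding True by (simp flip: power_add)
      then have "q * q ^ 4 \<le> q ^ n" using q_power_n by (simp only:)
      then show ?thesis by simp
    qed
    finally show ?thesis using True num_above_self[of 2] by simp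
  next
    case False
    then have "real (card \<F>) * (a - q) \<le> (2 * bracket k * num_above k 2) * (a - q)"
      using k_ge_2 qa by (intro mult_right_mono card_family_le) auto
    also have "\<dots> = (2 * bracket k * (a - q)) * num_above k 2" by simp
    also have "\<dots> < (q ^ n - a) * num_above k 2"
    proof (rule mult_strict_right_mono[OF _ N])
      have "(q - 1) * (2 * bracket k * (a - q)) = 2 * (a - 1) * (a - q)"
        using bracket_mult[of k] by (simp add: a_def)
      also have "\<dots> < 2 * (a * a) - a"
      proof -
        have "q * 1 \<le> q * a" using q qa by (intro mult_left_mono) auto
        moreover have "2 * (a - 1) * (a - q) = 2 * (a * a) - 2 * a - 2 * (q * a) + 2 * q"
          by (simp add: algebra_simps)
        ultimately show ?thesis using q qa by linarith
      qed
      also have "\<dots> \<le> q ^ n - a"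
      proof -
        have "2 * (a * a) \<le> q * (a * a)" using q by (intro mult_right_mono) auto
        then show ?thesis using q_power_n by (simp add: a_def mult.assoc)
      qed
      also have "\<dots> \<le> (q - 1) * (q ^ n - a)"
        using q q_power_le[of k n] n_ge mult_right_mono[of 1 "q - 1" "q ^ n - a"]
        by (simp add: a_def)
      finally show "2 * bracket k * (a - q) < q ^ n - a" using q by simp
    qed
    finally show ?thesis by (simp add: a_def)
  qed
qed

text \<open>The witness is a \<open>k\<close>-space of at most average degree among those that avoid a member \<open>Y\<close>; it is
  not a member because it does not meet \<open>Y\<close>.\<close>

lemma exists_nonmember_below:
  obtains S where "S \<in> Gr scale k UNIV - \<F>"
    and "real (subspace_degree scale \<F> S) < bracket k * num_above k 2"
proof -
  obtain Y where Y: "Y \<in> \<F>" using nonempty by blast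
  have sY: "subspace Y" and dY: "dim Y = k" using member Y by auto
  define g where "g v = real (point_degree \<F> (span {v}))" for v
  have q: "q \<ge> 2" by (rule q_ge_2)
  obtain S where S: "S \<in> avoiding k Y {0}"
    and avg: "(q ^ n - q ^ k) * (\<Sum>v\<in>S - {0}. g v) \<le> (q ^ k - 1) * (\<Sum>v\<in>UNIV - Y. g v)"
    using exists_avoiding_below_average[OF sY, of k g] k_ge_2 n_ge dY by auto
  have sS: "subspace S" using S by (simp add: avoiding_def Gr_iff)
  have "(\<Sum>v\<in>UNIV - Y. g v) \<le> real (card \<F>) * (q ^ k - q)"
  proof -
    have "span {v} \<subseteq> A \<longleftrightarrow> v \<in> A" if "A \<in> \<F>" for v A
      using span_insert_subset_iff[of "{0}" A v] member(1)[OF that] subspace_0[of A]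
      by (simp add: insert_commute)
    then have "g v = real (card {A \<in> \<F>. v \<in> A})" for v
      unfolding g_def point_degree_def by (auto intro!: arg_cong[of _ _ card])
    then have "(\<Sum>v\<in>UNIV - Y. g v) = real (\<Sum>v\<in>UNIV - Y. card {A \<in> \<F>. v \<in> A})"
      by simp
    also have "\<dots> = real (\<Sum>A\<in>\<F>. card {v \<in> UNIV - Y. v \<in> A})"
      using sum_multicount_gen[of \<F> "UNIV - Y" "\<lambda>A v. v \<in> A" "\<lambda>v. card {A \<in> \<F>. v \<in> A}"] by simp
    also have "\<dots> = (\<Sum>A\<in>\<F>. real (card (A - Y \<inter> A)))"
      unfolding of_nat_sum
      by (intro sum.cong arg_cong[of _ _ "\<lambda>B. real (card B)"]) auto
    also have "\<dots> \<le> (\<Sum>A\<in>\<F>. q ^ k - q)"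
    proof (rule sum_mono)
      fix A assume A: "A \<in> \<F>"
      have sYA: "subspace (Y \<inter> A)" using sY member A by (simp add: subspace_inter)
      have "dim (Y \<inter> A) \<ge> 1" using meet[OF Y A] dim_pos_iff[OF sYA] by blast
      then have "q ^ 1 \<le> q ^ dim (Y \<inter> A)" by (rule q_power_le)
      then show "real (card (A - Y \<inter> A)) \<le> q ^ k - q"
        using card_subspace_diff[OF sYA, of A] member A by simp
    qed
    finally show ?thesis by simp
  qed
  then have "(q ^ n - q ^ k) * ((q - 1) * real (subspace_degree scale \<F> S))
      \<le> (q ^ k - 1) * (real (card \<F>) * (q ^ k - q))"
    unfolding subspace_degree_eq[OF sS] g_def[symmetric]
    using q_power_le[of 0 k] by (intro order_trans[OF avg] mult_left_mono) auto
  also have "\<dots> < (q ^ k - 1) * ((q ^ n - q ^ k) * num_above k 2)"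
    using card_family_less q_power_less[of 0 k] k_ge_2 by (intro mult_strict_left_mono) auto
  also have "\<dots> = (q ^ n - q ^ k) * ((q - 1) * (bracket k * num_above k 2))"
    unfolding bracket_mult[symmetric] by simp
  finally have "real (subspace_degree scale \<F> S) < bracket k * num_above k 2"
    using q_power_less[of k n] n_ge q by simp
  moreover have "S \<notin> \<F>"
  proof
    assume "S \<in> \<F>"
    then show False using meet[OF _ Y, of S] S by (auto simp: avoiding_def)
  qed
  ultimately show ?thesis using that S by (auto simp: avoiding_def)
qed

end

section \<open>Stars and the projective Ore-degree\<close>

context finite_field_space
begin

lemma point_eq_span:
  assumes "X \<in> Gr scale 1 UNIV" "v \<in> X" "v \<noteq> 0"
  shows "X = span {v}"
  using assms subspace_dim_equal[of "span {v}" X] span_minimal[of "{v}" X] by (simp add: Gr_iff)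

lemma subspace_degree_star:
  assumes X: "X \<in> Gr scale 1 UNIV" and S: "S \<in> Gr scale k UNIV" and XS: "\<not> X \<subseteq> S"
    and k: "2 \<le> k"
  shows "real (subspace_degree scale {A \<in> Gr scale k UNIV. X \<subseteq> A} S) = bracket k * num_above k 2"
proof -
  have sS: "subspace S" and dS: "dim S = k" and sX: "subspace X" and dX: "dim X = 1"
    using X S by (auto simp: Gr_iff)
  have "real (point_degree {A \<in> Gr scale k UNIV. X \<subseteq> A} (span {v})) = num_above k 2"
    if v: "v \<in> S - {0}" for v
  proof -
    have "v \<notin> X"
      using point_eq_span[OF X, of v] v XS sS span_minimal[of "{v}" S] by auto
    then have d: "dim (span (insert v X)) = 2" using dim_span_insert[OF sX] dX by simp
    have "span {v} \<subseteq> A \<longleftrightarrow> v \<in> A" if "subspace A" for A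
      using span_insert_subset_iff[of "{0}" A v] subspace_0[OF that] that
      by (simp add: insert_commute)
    then have "{A \<in> {A \<in> Gr scale k UNIV. X \<subseteq> A}. span {v} \<subseteq> A}
        = {A \<in> Gr scale k UNIV. span (insert v X) \<subseteq> A}"
      using span_insert_subset_iff[OF sX] by (simp add: Gr_iff) blast
    then show ?thesis
      using card_above[OF subspace_span, of "insert v X" k] d k
      by (simp add: point_degree_def del: dim_span)
  qed
  then have "(q - 1) * real (subspace_degree scale {A \<in> Gr scale k UNIV. X \<subseteq> A} S)
      = real (card (S - {0})) * num_above k 2"
    unfolding subspace_degree_eq[OF sS] by simp
  also have "\<dots> = (q - 1) * (bracket k * num_above k 2)"
    unfolding card_nonzero_vectors[OF sS] dS bracket_mult[symmetric] by simp
  finally show ?thesis using q_ge_2 by simp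
qed

lemma exists_missing_star:
  assumes X: "X \<in> Gr scale 1 UNIV" and M: "subspace M" "M \<inter> X \<subseteq> {0}" "dim M \<le> k" and k: "k < n"
  obtains S where "S \<in> Gr scale k UNIV" "M \<subseteq> S" "\<not> X \<subseteq> S"
proof -
  have sX: "subspace X" and dX: "dim X = 1" using X by (auto simp: Gr_iff)
  then obtain S where S: "S \<in> avoiding k X M"
    using avoiding_nonempty[of X M k] M k by auto
  have "\<not> X \<subseteq> {0}" using dim_pos_iff[OF sX] dX by simp
  then show ?thesis using that S by (auto simp: avoiding_def)
qed

text \<open>Let \<open>A\<close> be missing from \<open>\<F>\<close> and \<open>w \<in> A\<close> outside \<open>X\<close>. At the point of \<open>w\<close> the degree of \<open>\<F>\<close> is
  smaller than that of the star, so any \<open>k\<close>-space through \<open>w\<close> and off \<open>X\<close> will do.\<close>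

lemma exists_below_star:
  assumes X: "X \<in> Gr scale 1 UNIV" and sub: "\<F> \<subset> {A \<in> Gr scale k UNIV. X \<subseteq> A}"
    and k: "2 \<le> k" "k < n"
  obtains S where "S \<in> Gr scale k UNIV - \<F>"
    and "real (subspace_degree scale \<F> S) < bracket k * num_above k 2"
proof -
  let ?star = "{A \<in> Gr scale k UNIV. X \<subseteq> A}"
  have sX: "subspace X" and dX: "dim X = 1" using X by (auto simp: Gr_iff)
  obtain A where A: "A \<in> ?star" "A \<notin> \<F>" using sub by blast
  have "\<not> A \<subseteq> X"
    using A dX k dim_subset[of A X] by (auto simp: Gr_iff)
  then obtain w where w: "w \<in> A" "w \<notin> X" by blast
  have w0: "w \<noteq> 0" using w subspace_0[OF sX] by blast
  have "span {w} \<inter> X \<subseteq> {0}"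
  proof
    fix x assume x: "x \<in> span {w} \<inter> X"
    show "x \<in> {0}"
    proof (rule ccontr)
      assume "x \<notin> {0}"
      then have "span {x} = span {w}"
        using x w0 point_eq_span[of "span {w}" x] by (simp add: Gr_iff)
      then show False
        using x w sX span_minimal[of "{x}" X] span_superset[of "{w}"] by auto
    qed
  qed
  then obtain S where S: "S \<in> Gr scale k UNIV" "span {w} \<subseteq> S" "\<not> X \<subseteq> S"
    using exists_missing_star[OF X subspace_span, of "{w}" k] w0 k by auto
  have "subspace_degree scale \<F> S < subspace_degree scale ?star S"
    unfolding subspace_degree_def
  proof (rule sum_strict_mono_ex1)
    have fin: "finite ?star" by simp
    show "\<forall>x\<in>Gr scale 1 S. point_degree \<F> x \<le> point_degree ?star x"
      unfolding point_degree_def using sub by (intro ballI card_mono) auto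
    have "A \<in> {B \<in> ?star. span {w} \<subseteq> B}"
      using A w span_minimal[of "{w}" A] by (auto simp: Gr_iff)
    then have "{B \<in> \<F>. span {w} \<subseteq> B} \<subset> {B \<in> ?star. span {w} \<subseteq> B}"
      using A sub by blast
    then have "point_degree \<F> (span {w}) < point_degree ?star (span {w})"
      unfolding point_degree_def by (intro psubset_card_mono) auto
    moreover have "span {w} \<in> Gr scale 1 S" using S w0 by (simp add: Gr_iff)
    ultimately show "\<exists>x\<in>Gr scale 1 S. point_degree \<F> x < point_degree ?star x" by blast
  qed simp
  then have "real (subspace_degree scale \<F> S) < bracket k * num_above k 2"
    unfolding subspace_degree_star[OF X S(1,3) k(1), symmetric] by simp
  moreover have "S \<notin> \<F>" using S sub by auto
  ultimately show ?thesis using that S by blast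
qed

lemma ore_degree_star:
  assumes "full_point_star scale k UNIV \<F>" and k: "2 \<le> k" "k < n"
  shows "real (ore_degree scale k UNIV \<F>) = bracket k * num_above k 2"
proof -
  obtain X where X: "X \<in> Gr scale 1 UNIV" and F: "\<F> = {A \<in> Gr scale k UNIV. X \<subseteq> A}"
    using assms by (auto simp: full_point_star_def)
  obtain S where S: "S \<in> Gr scale k UNIV" "\<not> X \<subseteq> S"
    by (rule exists_missing_star[OF X, of "{0}" k]) (use k in auto)
  have deg: "real (subspace_degree scale \<F> T) = bracket k * num_above k 2"
    if "T \<in> Gr scale k UNIV - \<F>" for T
    using that subspace_degree_star[OF X, of T k] k F by auto
  have "ore_degree scale k UNIV \<F> \<in> subspace_degree scale \<F> ` (Gr scale k UNIV - \<F>)"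
    unfolding ore_degree_def using S F by (intro Min_in) auto
  then show ?thesis using deg by auto
qed

lemma ore_degree_less:
  assumes "intersecting scale \<F>" "\<F> \<subseteq> Gr scale k UNIV" "\<not> full_point_star scale k UNIV \<F>"
    and k: "2 \<le> k" "2 * k + 1 \<le> n"
  shows "real (ore_degree scale k UNIV \<F>) < bracket k * num_above k 2"
proof -
  obtain S where S: "S \<in> Gr scale k UNIV - \<F>"
    and less: "real (subspace_degree scale \<F> S) < bracket k * num_above k 2"
  proof (cases "\<exists>v. v \<noteq> 0 \<and> (\<forall>A\<in>\<F>. v \<in> A)")
    case True
    then obtain v where v: "v \<noteq> 0" "\<forall>A\<in>\<F>. v \<in> A" by blast
    have X: "span {v} \<in> Gr scale 1 UNIV" using v by (simp add: Gr_iff)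
    have "\<F> \<subseteq> {A \<in> Gr scale k UNIV. span {v} \<subseteq> A}"
    proof
      fix A assume A: "A \<in> \<F>"
      then have "A \<in> Gr scale k UNIV" "v \<in> A" using assms(2) v by auto
      then show "A \<in> {A \<in> Gr scale k UNIV. span {v} \<subseteq> A}"
        using span_minimal[of "{v}" A] by (simp add: Gr_iff)
    qed
    then have "\<F> \<subset> {A \<in> Gr scale k UNIV. span {v} \<subseteq> A}"
      using X assms(3) unfolding full_point_star_def by blast
    then obtain T where "T \<in> Gr scale k UNIV - \<F>"
        "real (subspace_degree scale \<F> T) < bracket k * num_above k 2"
      by (rule exists_below_star[OF X]) (use k in auto)
    then show ?thesis by (rule that)
  next
    case False
    interpret centreless_intersecting_family scale Basis q n k \<F>
    proof
      show "\<not> A \<inter> B \<subseteq> {0}" if "A \<in> \<F>" "B \<in> \<F>" for A B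
      proof -
        have "A \<in> Gr scale k UNIV" "B \<in> Gr scale k UNIV" using that assms(2) by auto
        then have "subspace (A \<inter> B)" by (intro subspace_inter) (simp_all add: Gr_iff)
        then show ?thesis using assms(1) that dim_pos_iff unfolding intersecting_def by blast
      qed
    qed (use assms False in auto)
    show ?thesis using exists_nonmember_below that by blast
  qed
  have "ore_degree scale k UNIV \<F> \<le> subspace_degree scale \<F> S"
    unfolding ore_degree_def using S by (intro Min_le) auto
  then show ?thesis using less by linarith
qed

end

theorem theorem1p1:
  fixes scale :: "'a::{field,finite} \<Rightarrow> 'v::ab_group_add \<Rightarrow> 'v"
    and q k n :: nat
    and \<F> :: "'v set set"
  assumes "vector_space scale"
    and "CARD('a) = q"
    and "vector_space.dim scale (UNIV :: 'v set) = n"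
    and "k \<ge> 2"
    and "n \<ge> 2 * k + 1"
    and "\<F> \<subseteq> Gr scale k UNIV"
    and "intersecting scale \<F>"
  shows "real (ore_degree scale k UNIV \<F>)
           \<le> gaussian q k 1 * gaussian q (n - 2) (k - 2)
       \<and> (real (ore_degree scale k UNIV \<F>)
             = gaussian q k 1 * gaussian q (n - 2) (k - 2)
           \<longleftrightarrow> full_point_star scale k UNIV \<F>)"
proof -
  interpret V: vector_space scale by fact
  obtain B where B: "V.independent B" "UNIV \<subseteq> V.span B" "card B = n"
    using V.basis_exists[of UNIV] assms(3) by metis
  have "finite B" using B assms by (metis add_is_0 card.infinite le_zero_eq zero_neq_one)
  then interpret finite_field_space scale B "real q" n
    using B assms(2) by unfold_locales auto
  have bound: "gaussian q k 1 * gaussian q (n - 2) (k - 2) = bracket k * num_above k 2"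
    using gaussian_eq_bracket[of k] gaussian_eq_num_above[of k] assms by simp
  show ?thesis
    unfolding bound
    using ore_degree_star[of k \<F>] ore_degree_less[OF assms(7,6) _ assms(4,5)] assms(4,5)
    by (cases "full_point_star scale k UNIV \<F>") auto
qed

end
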